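(* Let $(X,\mathcal{F},\tau_\ast)$ be a complete Menger space such that $\alpha\ast\alpha\ge\alpha$ for all $\alpha\in[0,1]$. Let $f:X\to X$ be a probabilistic TSR P-contraction mapping with contraction constant less than or equal to $\frac12$; that is, for every $t>0$ there exists $k\in(0,\frac12]$ such that $$1-F_{f(x),f(y)}(k^{m+1}t)\le k\bigl(1-F_{x,y}(k^m t)\bigr)\quad\text{for all }x,y\in X\text{ and all }m\in\mathbb{N}=\{0,1,2,\dots\}.$$ Then $f$ has a unique fixed point in $X$.
   Context: A t-norm is a binary operation $\ast$ on $[0,1]$ that is commutative, associative, non-decreasing in each argument, and satisfies $x\ast 1=x$. A distance distribution function is a non-decreasing function $F:[-\infty,\infty]\to[0,1]$, left continuous on $\mathbb{R}$, with $F(-\infty)=0$, $F(\infty)=1$, $F(0)=0$; the set of these is $\Delta^+$. $H_0\in\Delta^+$ is given by $H_0(u)=0$ for $u\le 0$ and $H_0(u)=1$ for $u>0$. A triangle function is a binary operation $\tau$ on $\Delta^+$ that is commutative, associative, non-decreasing in each place (pointwise order), with identity $H_0$. A probabilistic metric space (PM space) is a triple $(X,\mathcal{F},\tau)$ with $X$ a nonempty set, $\tau$ a triangle function, and $\mathcal{F}:X\times X\to\Delta^+$, $(p,q)\mapsto F_{p,q}$, such that for all $p,q,r\in X$: (i) $F_{p,q}=H_0$ iff $p=q$; (ii) $F_{p,q}=F_{q,p}$; (iii) $F_{p,r}\ge\tau(F_{p,q},F_{q,r})$. A Menger space $(X,\mathcal{F},\tau_\ast)$ is a PM space whose triangle function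 is $\tau_\ast$, where for a t-norm $\ast$, $\tau_\ast(F,G)(t)=\sup\{F(t_1)\ast G(t_2): t_1+t_2=t,\ t_1,t_2\ge 0\}$ for $t\ge 0$. A sequence $\{x_n\}$ in $X$ converges to $x\in X$ if for all $\alpha\in(0,1)$ and $t>0$ there is a natural number $m$ with $F_{x_n,x}(t)>1-\alpha$ for all $n\ge m$. It is a Cauchy sequence if for all $\alpha\in(0,1)$ and $t>0$ there is a natural number $m$ with $F_{x_{n+p},x_n}(t)>1-\alpha$ for all $n\ge m$ and all natural numbers $p$. The space is complete if every Cauchy sequence converges to a point of $X$. The constant $k$ in the definition of a TSR P-contraction (the contraction constant) may depend on $t$ but not on $x,y,m$. *)

theory Defs
  imports "HOL-Analysis.Analysis"
begin

definition t_norm :: "(real \<Rightarrow> real \<Rightarrow> real) \<Rightarrow> bool" where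
  "t_norm T \<longleftrightarrow>
     (\<forall>x\<in>{0..1}. \<forall>y\<in>{0..1}. T x y \<in> {0..1}) \<and>
     (\<forall>x\<in>{0..1}. \<forall>y\<in>{0..1}. T x y = T y x) \<and>
     (\<forall>x\<in>{0..1}. \<forall>y\<in>{0..1}. \<forall>z\<in>{0..1}. T (T x y) z = T x (T y z)) \<and>
     (\<forall>x\<in>{0..1}. \<forall>x'\<in>{0..1}. \<forall>y\<in>{0..1}. \<forall>y'\<in>{0..1}.
        x \<le> x' \<longrightarrow> y \<le> y' \<longrightarrow> T x y \<le> T x' y') \<and>
     (\<forall>x\<in>{0..1}. T x 1 = x)"

definition Delta_plus :: "(ereal \<Rightarrow> real) set" where
  "Delta_plus = {F. mono F \<and> range F \<subseteq> {0..1} \<and>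
     (\<forall>u::real. continuous (at_left (ereal u)) F) \<and>
     F (-\<infinity>) = 0 \<and> F \<infinity> = 1 \<and> F 0 = 0}"

definition H0 :: "ereal \<Rightarrow> real" where
  "H0 u = (if u \<le> 0 then 0 else 1)"

text \<open>The order on distance distribution functions is the pointwise order of the function type.\<close>

definition triangle_function ::
  "((ereal \<Rightarrow> real) \<Rightarrow> (ereal \<Rightarrow> real) \<Rightarrow> (ereal \<Rightarrow> real)) \<Rightarrow> bool" where
  "triangle_function \<tau> \<longleftrightarrow>
     (\<forall>F\<in>Delta_plus. \<forall>G\<in>Delta_plus. \<tau> F G \<in> Delta_plus) \<and>
     (\<forall>F\<in>Delta_plus. \<forall>G\<in>Delta_plus. \<tau> F G = \<tau> G F) \<and>
     (\<forall>F\<in>Delta_plus. \<forall>G\<in>Delta_plus. \<forall>H\<in>Delta_plus. \<tau> (\<tau> F G) H = \<tau> F (\<tau> G H)) \<and>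
     (\<forall>F\<in>Delta_plus. \<forall>F'\<in>Delta_plus. \<forall>G\<in>Delta_plus. \<forall>G'\<in>Delta_plus.
        F \<le> F' \<longrightarrow> G \<le> G' \<longrightarrow> \<tau> F G \<le> \<tau> F' G') \<and>
     (\<forall>F\<in>Delta_plus. \<tau> F H0 = F)"

definition pm_space ::
  "'a set \<Rightarrow> ('a \<Rightarrow> 'a \<Rightarrow> ereal \<Rightarrow> real) \<Rightarrow>
   ((ereal \<Rightarrow> real) \<Rightarrow> (ereal \<Rightarrow> real) \<Rightarrow> (ereal \<Rightarrow> real)) \<Rightarrow> bool" where
  "pm_space X \<F> \<tau> \<longleftrightarrow>
     X \<noteq> {} \<and> triangle_function \<tau> \<and>
     (\<forall>p\<in>X. \<forall>q\<in>X. \<F> p q \<in> Delta_plus) \<and>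
     (\<forall>p\<in>X. \<forall>q\<in>X. \<F> p q = H0 \<longleftrightarrow> p = q) \<and>
     (\<forall>p\<in>X. \<forall>q\<in>X. \<F> p q = \<F> q p) \<and>
     (\<forall>p\<in>X. \<forall>q\<in>X. \<forall>r\<in>X. \<tau> (\<F> p q) (\<F> q r) \<le> \<F> p r)"

text \<open>The supremum is taken for nonnegative arguments, including infinity. The value 0 at negative
  arguments is the only one compatible with the result being a distance distribution function.\<close>

definition tau_star ::
  "(real \<Rightarrow> real \<Rightarrow> real) \<Rightarrow> (ereal \<Rightarrow> real) \<Rightarrow> (ereal \<Rightarrow> real) \<Rightarrow> ereal \<Rightarrow> real" where
  "tau_star T F G t =
     (if t \<ge> 0 then Sup {T (F t1) (G t2) | t1 t2. t1 + t2 = t \<and> t1 \<ge> 0 \<and> t2 \<ge> 0} else 0)"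

definition menger_space ::
  "'a set \<Rightarrow> ('a \<Rightarrow> 'a \<Rightarrow> ereal \<Rightarrow> real) \<Rightarrow> (real \<Rightarrow> real \<Rightarrow> real) \<Rightarrow> bool" where
  "menger_space X \<F> T \<longleftrightarrow> t_norm T \<and> pm_space X \<F> (tau_star T)"

definition pm_converges ::
  "('a \<Rightarrow> 'a \<Rightarrow> ereal \<Rightarrow> real) \<Rightarrow> (nat \<Rightarrow> 'a) \<Rightarrow> 'a \<Rightarrow> bool" where
  "pm_converges \<F> s x \<longleftrightarrow>
     (\<forall>\<alpha>::real. \<forall>t::real. 0 < \<alpha> \<and> \<alpha> < 1 \<and> t > 0 \<longrightarrow>
        (\<exists>m. \<forall>n\<ge>m. \<F> (s n) x (ereal t) > 1 - \<alpha>))"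

definition pm_Cauchy :: "('a \<Rightarrow> 'a \<Rightarrow> ereal \<Rightarrow> real) \<Rightarrow> (nat \<Rightarrow> 'a) \<Rightarrow> bool" where
  "pm_Cauchy \<F> s \<longleftrightarrow>
     (\<forall>\<alpha>::real. \<forall>t::real. 0 < \<alpha> \<and> \<alpha> < 1 \<and> t > 0 \<longrightarrow>
        (\<exists>m. \<forall>n\<ge>m. \<forall>p. \<F> (s (n + p)) (s n) (ereal t) > 1 - \<alpha>))"

definition pm_complete :: "'a set \<Rightarrow> ('a \<Rightarrow> 'a \<Rightarrow> ereal \<Rightarrow> real) \<Rightarrow> bool" where
  "pm_complete X \<F> \<longleftrightarrow>
     (\<forall>s. range s \<subseteq> X \<and> pm_Cauchy \<F> s \<longrightarrow> (\<exists>x\<in>X. pm_converges \<F> s x))"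

end

theory Submission
  imports Defs
begin

text \<open>The hypothesis \<open>T \<alpha> \<alpha> \<ge> \<alpha>\<close> gives \<open>T \<ge> min\<close>, so the triangle inequality reads
  \<open>F\<^sub>x\<^sub>z (s + t) \<ge> min (F\<^sub>x\<^sub>y s) (F\<^sub>y\<^sub>z t)\<close>. Iterating the contraction at \<open>t = 1\<close>, the orbit satisfies
  \<open>F (2\<^sup>-\<^sup>n) \<ge> 1 - 2\<^sup>-\<^sup>n\<close> for consecutive points \<open>x\<^sub>n\<close>, \<open>x\<^sub>n\<^sub>+\<^sub>1\<close>. The geometric series of the scales then
  makes the orbit Cauchy, and \<open>k \<le> 1\<close> makes \<open>f\<close> continuous, so the limit is fixed.\<close>

lemma t_norm_mono:
  assumes "t_norm T" "x \<in> {0..1}" "x' \<in> {0..1}" "y \<in> {0..1}" "y' \<in> {0..1}" "x \<le> x'" "y \<le> y'"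
  shows "T x y \<le> T x' y'"
proof -
  have "\<forall>x\<in>{0..1}. \<forall>x'\<in>{0..1}. \<forall>y\<in>{0..1}. \<forall>y'\<in>{0..1}.
      x \<le> x' \<longrightarrow> y \<le> y' \<longrightarrow> T x y \<le> T x' y'"
    using assms(1) unfolding t_norm_def by (elim conjE)
  from this[rule_format, OF assms(2-7)] show ?thesis .
qed

text \<open>Both arguments dominate their minimum, so monotonicity reduces the claim to the
  diagonal, where the idempotence hypothesis applies.\<close>

lemma t_norm_ge_min:
  assumes "t_norm T" "\<forall>\<alpha>\<in>{0..1}. T \<alpha> \<alpha> \<ge> \<alpha>" "a \<in> {0..1}" "b \<in> {0..1}"
  shows "min a b \<le> T a b"
proof -
  let ?c = "min a b"
  have c: "?c \<in> {0..1}" using assms by (auto simp: min_def)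
  have "?c \<le> T ?c ?c" using assms(2) c by blast
  also have "\<dots> \<le> T a b"
    by (rule t_norm_mono[OF assms(1) c assms(3) c assms(4)]) simp_all
  finally show ?thesis .
qed

lemma Delta_plus_range: "F \<in> Delta_plus \<Longrightarrow> F u \<in> {0..1}"
  unfolding Delta_plus_def by blast

lemma Delta_plus_mono: "F \<in> Delta_plus \<Longrightarrow> u \<le> v \<Longrightarrow> F u \<le> F v"
  unfolding Delta_plus_def by (auto dest: monoD)

text \<open>Turns estimates at positive real scales into equality of points, via the axiom that
  \<open>H0\<close> characterizes \<open>p = q\<close>. Monotonicity and \<open>F 0 = 0\<close>
  settle \<open>u \<le> 0\<close>; the value at infinity is prescribed.\<close>

lemma Delta_plus_eq_H0:
  assumes F: "F \<in> Delta_plus" and one: "\<And>t::real. t > 0 \<Longrightarrow> F (ereal t) \<ge> 1"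
  shows "F = H0"
proof
  fix u :: ereal
  have F0: "F 0 = 0" and Finf: "F \<infinity> = 1" using F by (auto simp: Delta_plus_def)
  have r: "F u \<in> {0..1}" using Delta_plus_range[OF F] .
  show "F u = H0 u"
  proof (cases "u \<le> 0")
    case True
    then show ?thesis using Delta_plus_mono[OF F True] F0 r by (simp add: H0_def)
  next
    case False
    then have "F u \<ge> 1" using one Finf by (cases u) auto
    then show ?thesis using False r by (simp add: H0_def)
  qed
qed

text \<open>A real \<open>Sup\<close> bounds its members only if the set is bounded above; here 1 is
  a bound because the t-norm takes values in the unit interval.\<close>

lemma tau_star_ge:
  assumes "t_norm T" "F \<in> Delta_plus" "G \<in> Delta_plus" "0 \<le> s" "0 \<le> t"
  shows "T (F s) (G t) \<le> tau_star T F G (s + t)"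
proof -
  let ?S = "{T (F t1) (G t2) | t1 t2. t1 + t2 = s + t \<and> t1 \<ge> 0 \<and> t2 \<ge> 0}"
  have "bdd_above ?S"
  proof (rule bdd_aboveI[of _ 1])
    fix z assume "z \<in> ?S"
    then obtain t1 t2 where z: "z = T (F t1) (G t2)" by blast
    have "T (F t1) (G t2) \<in> {0..1}"
      using assms(1) Delta_plus_range[OF assms(2)] Delta_plus_range[OF assms(3)]
      unfolding t_norm_def by blast
    then show "z \<le> 1" by (simp add: z)
  qed
  moreover have "T (F s) (G t) \<in> ?S" using assms(4,5) by blast
  ultimately have "T (F s) (G t) \<le> Sup ?S" by (rule cSup_upper[rotated])
  then show ?thesis using assms(4,5) by (simp add: tau_star_def)
qed

lemma menger_space_triangle_min:
  fixes s t :: real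
  assumes "menger_space X \<F> T" "\<forall>\<alpha>\<in>{0..1}. T \<alpha> \<alpha> \<ge> \<alpha>"
    and "x \<in> X" "y \<in> X" "z \<in> X" "0 \<le> s" "0 \<le> t"
  shows "min (\<F> x y (ereal s)) (\<F> y z (ereal t)) \<le> \<F> x z (ereal (s + t))"
proof -
  have T: "t_norm T" and pm: "pm_space X \<F> (tau_star T)"
    using assms(1) by (auto simp: menger_space_def)
  have D: "\<F> x y \<in> Delta_plus" "\<F> y z \<in> Delta_plus"
    using pm assms(3-5) by (auto simp: pm_space_def)
  have "min (\<F> x y (ereal s)) (\<F> y z (ereal t)) \<le> T (\<F> x y (ereal s)) (\<F> y z (ereal t))"
    by (intro t_norm_ge_min T assms(2) Delta_plus_range D)
  also have "\<dots> \<le> tau_star T (\<F> x y) (\<F> y z) (ereal s + ereal t)"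
    by (rule tau_star_ge[OF T D]) (use assms(6,7) in auto)
  also have "\<dots> \<le> \<F> x z (ereal s + ereal t)"
    using pm assms(3-5) by (auto simp: pm_space_def le_fun_def)
  finally show ?thesis by simp
qed

text \<open>The triangle inequality takes a minimum, so along a chain of steps the errors do not add
  up; only the scales do, and their geometric series converges.\<close>

lemma pm_Cauchy_if_geometric:
  assumes M: "menger_space X \<F> T" "\<forall>\<alpha>\<in>{0..1}. T \<alpha> \<alpha> \<ge> \<alpha>"
    and X: "range s \<subseteq> X"
    and step: "\<And>n. 1 - (1/2)^n \<le> \<F> (s (Suc n)) (s n) (ereal ((1/2)^n))"
  shows "pm_Cauchy \<F> s"
proof -
  have pm: "pm_space X \<F> (tau_star T)" using M(1) by (simp add: menger_space_def)
  have sX: "s i \<in> X" for i using X by auto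
  have D: "\<F> (s i) (s j) \<in> Delta_plus" for i j
    using pm sX by (auto simp: pm_space_def)
  \<comment> \<open>The constant 2 makes the induction close: the tail from \<open>Suc n\<close> has
    scale \<open>2 * (1/2)^Suc n = (1/2)^n\<close>, and the step from \<open>n\<close> to
    \<open>Suc n\<close> adds another \<open>(1/2)^n\<close>. The induction hypothesis is therefore
    needed at \<open>Suc n\<close>.\<close>
  have far: "1 - (1/2)^n \<le> \<F> (s (n + p)) (s n) (ereal (2 * (1/2)^n))" for n p
  proof (induction p arbitrary: n)
    case 0
    have "\<F> (s n) (s n) = H0" using pm sX by (simp add: pm_space_def)
    moreover have "\<not> (1/2::real)^n \<le> 0" by (simp add: not_le)
    ultimately show ?case by (simp add: H0_def)
  next
    case (Suc p)
    have "1 - (1/2)^n \<le> 1 - (1/2::real)^Suc n" by simp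
    also have "\<dots> \<le> \<F> (s (Suc n + p)) (s (Suc n)) (ereal ((1/2)^n))"
      using Suc.IH[of "Suc n"] by simp
    finally have "1 - (1/2)^n \<le> min (\<F> (s (Suc n + p)) (s (Suc n)) (ereal ((1/2)^n)))
        (\<F> (s (Suc n)) (s n) (ereal ((1/2)^n)))"
      using step by simp
    also have "\<dots> \<le> \<F> (s (Suc n + p)) (s n) (ereal ((1/2)^n + (1/2)^n))"
      by (rule menger_space_triangle_min[OF M]) (use X in auto)
    also have "(1/2)^n + (1/2)^n = 2 * (1/2::real)^n" by simp
    finally show ?case by simp
  qed
  show ?thesis
    unfolding pm_Cauchy_def
  proof (intro allI impI)
    fix \<alpha> t :: real assume a: "0 < \<alpha> \<and> \<alpha> < 1 \<and> t > 0"
    \<comment> \<open>One power of 1/2 has to control both the error, below \<open>\<alpha>\<close>,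
      and the scale \<open>2 * (1/2)^m\<close>, below \<open>t\<close>.\<close>
    have "0 < min \<alpha> (t/2)" "(1/2::real) < 1" using a by simp_all
    from real_arch_pow_inv[OF this] obtain m where m: "(1/2::real)^m < min \<alpha> (t/2)" by blast
    show "\<exists>m. \<forall>n\<ge>m. \<forall>p. \<F> (s (n + p)) (s n) (ereal t) > 1 - \<alpha>"
    proof (intro exI allI impI)
      fix n p assume "m \<le> n"
      then have "(1/2::real)^n \<le> (1/2)^m" by (intro power_decreasing) auto
      with m have n: "(1/2::real)^n < \<alpha>" "2 * (1/2::real)^n \<le> t" by linarith+
      have "1 - \<alpha> < 1 - (1/2)^n" using n by simp
      also have "\<dots> \<le> \<F> (s (n + p)) (s n) (ereal (2 * (1/2)^n))" by (rule far)
      also have "\<dots> \<le> \<F> (s (n + p)) (s n) (ereal t)"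
        using n by (intro Delta_plus_mono D) simp
      finally show "\<F> (s (n + p)) (s n) (ereal t) > 1 - \<alpha>" .
    qed
  qed
qed

theorem theorem3p3:
  fixes X :: "'a set"
    and \<F> :: "'a \<Rightarrow> 'a \<Rightarrow> ereal \<Rightarrow> real"
    and T :: "real \<Rightarrow> real \<Rightarrow> real"
    and f :: "'a \<Rightarrow> 'a"
  assumes "menger_space X \<F> T"
    and "pm_complete X \<F>"
    and "\<forall>\<alpha>\<in>{0..1}. T \<alpha> \<alpha> \<ge> \<alpha>"
    and "f \<in> X \<rightarrow> X"
    and "\<forall>t::real. t > 0 \<longrightarrow>
           (\<exists>k::real. 0 < k \<and> k \<le> 1/2 \<and>
              (\<forall>x\<in>X. \<forall>y\<in>X. \<forall>m::nat.
                 1 - \<F> (f x) (f y) (ereal (k ^ (m + 1) * t))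
                   \<le> k * (1 - \<F> x y (ereal (k ^ m * t)))))"
  shows "\<exists>!x. x \<in> X \<and> f x = x"
proof -
  note M = assms(1,3)
  have pm: "pm_space X \<F> (tau_star T)" using assms(1) by (simp add: menger_space_def)
  have D: "\<F> x y \<in> Delta_plus" and H0_iff: "\<F> x y = H0 \<longleftrightarrow> x = y"
    and sym: "\<F> x y = \<F> y x" if "x \<in> X" "y \<in> X" for x y
    using pm that by (auto simp: pm_space_def)
  have fX: "f x \<in> X" if "x \<in> X" for x using assms(4) that by auto
  \<comment> \<open>This is the case \<open>m = 0\<close> with the scale \<open>k * t\<close>
    enlarged to \<open>t\<close>. Although \<open>k\<close> depends on \<open>t\<close>, the
    resulting factor 1/2 does not.\<close>
  have half: "1 - \<F> (f x) (f y) (ereal t) \<le> (1 - \<F> x y (ereal t)) / 2"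
    if "x \<in> X" "y \<in> X" "t > 0" for x y t
  proof -
    obtain k where k: "0 < k" "k \<le> 1/2" and kc: "\<forall>x\<in>X. \<forall>y\<in>X. \<forall>m::nat.
        1 - \<F> (f x) (f y) (ereal (k ^ (m + 1) * t)) \<le> k * (1 - \<F> x y (ereal (k ^ m * t)))"
      using assms(5) \<open>t > 0\<close> by blast
    have k0: "1 - \<F> (f x) (f y) (ereal (k * t)) \<le> k * (1 - \<F> x y (ereal t))"
      using kc[rule_format, OF \<open>x \<in> X\<close> \<open>y \<in> X\<close>, of 0] by simp
    have "k * t \<le> t" using k that by (simp add: mult_left_le_one_le)
    then have "\<F> (f x) (f y) (ereal (k * t)) \<le> \<F> (f x) (f y) (ereal t)"
      by (intro Delta_plus_mono D fX that) simp
    moreover have "k * (1 - \<F> x y (ereal t)) \<le> 1/2 * (1 - \<F> x y (ereal t))"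
      using k Delta_plus_range[OF D[OF that(1,2)], of "ereal t"] by (intro mult_right_mono) auto
    ultimately show ?thesis using k0 by simp
  qed

  obtain x0 where x0: "x0 \<in> X" using pm by (auto simp: pm_space_def)
  define s where "s n = (f ^^ n) x0" for n
  have s_Suc: "s (Suc n) = f (s n)" for n by (simp add: s_def)
  have sX: "s n \<in> X" for n
    by (induction n) (auto simp: s_Suc fX, simp add: s_def x0)
  \<comment> \<open>Fixing \<open>t = 1\<close> gives a single \<open>k\<close> for all steps of the
    orbit; the exponent \<open>m\<close> then counts the iterations.\<close>
  obtain k where k: "0 < k" "k \<le> 1/2" and kc: "\<And>x y m. x \<in> X \<Longrightarrow> y \<in> X \<Longrightarrow>
      1 - \<F> (f x) (f y) (ereal (k ^ Suc m)) \<le> k * (1 - \<F> x y (ereal (k ^ m)))"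
    using assms(5)[rule_format, of 1] by auto
  \<comment> \<open>Each application of \<open>f\<close> multiplies both the error and the scale by
    \<open>k\<close>; initially the error is at most 1.\<close>
  have iter: "1 - \<F> (s (Suc n)) (s n) (ereal (k ^ n)) \<le> k ^ n" for n
  proof (induction n)
    case 0
    show ?case using Delta_plus_range[OF D[OF sX sX]] by auto
  next
    case (Suc n)
    have "1 - \<F> (s (Suc (Suc n))) (s (Suc n)) (ereal (k ^ Suc n))
        \<le> k * (1 - \<F> (s (Suc n)) (s n) (ereal (k ^ n)))"
      using kc[OF sX sX, of "Suc n" n n] by (simp only: s_Suc)
    also have "\<dots> \<le> k * k ^ n" using Suc k by (intro mult_left_mono) auto
    finally show ?case by simp
  qed
  have "pm_Cauchy \<F> s"
  proof (rule pm_Cauchy_if_geometric[OF M])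
    fix n
    \<comment> \<open>Passing from \<open>k ^ n\<close> to \<open>(1/2) ^ n\<close> enlarges the
      scale and weakens the bound on the error, so both changes are harmless.\<close>
    have kn: "k ^ n \<le> (1/2) ^ n" using k by (intro power_mono) auto
    then have "\<F> (s (Suc n)) (s n) (ereal (k ^ n)) \<le> \<F> (s (Suc n)) (s n) (ereal ((1/2) ^ n))"
      by (intro Delta_plus_mono D sX) simp
    then show "1 - (1/2)^n \<le> \<F> (s (Suc n)) (s n) (ereal ((1/2)^n))"
      using iter[of n] kn by linarith
  qed (use sX in auto)
  then obtain x where x: "x \<in> X" and lim: "pm_converges \<F> s x"
    using assms(2) sX unfolding pm_complete_def by blast

  have "\<F> (f x) x = H0"
  proof (rule Delta_plus_eq_H0)
    fix t :: real assume t: "t > 0"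
    show "\<F> (f x) x (ereal t) \<ge> 1"
    proof (rule field_le_epsilon)
      fix e :: real assume e: "e > 0"
      \<comment> \<open>Convergence is only stated for errors below 1, hence the cap at 1/2.\<close>
      have "0 < min e (1/2) \<and> min e (1/2) < 1 \<and> t/2 > 0" using e t by (auto simp: min_less_iff_disj)
      then obtain m where m: "\<And>n. n \<ge> m \<Longrightarrow> \<F> (s n) x (ereal (t/2)) > 1 - min e (1/2)"
        using lim unfolding pm_converges_def by blast
      \<comment> \<open>Continuity of \<open>f\<close> at \<open>x\<close>: since
        \<open>s (Suc m) = f (s m)\<close>, closeness of \<open>s m\<close> to \<open>x\<close>
        passes to the images. The point \<open>s (Suc m)\<close> then links \<open>f x\<close> to
        \<open>x\<close>, each link using half of \<open>t\<close>.\<close>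
      have "1 - \<F> (f x) (s (Suc m)) (ereal (t/2)) \<le> (1 - \<F> (s m) x (ereal (t/2))) / 2"
        using half[OF sX x, of "t/2" m] t sym[OF fX[OF sX] fX[OF x], of m] by (simp add: s_Suc)
      then have "1 - e \<le> min (\<F> (f x) (s (Suc m)) (ereal (t/2))) (\<F> (s (Suc m)) x (ereal (t/2)))"
        using m[of m] m[of "Suc m"] e by (simp add: min_def split: if_splits)
      also have "\<dots> \<le> \<F> (f x) x (ereal (t/2 + t/2))"
        using t by (intro menger_space_triangle_min[OF M] fX x sX) auto
      finally show "1 \<le> \<F> (f x) x (ereal t) + e" by simp
    qed
  qed (intro D fX x)
  then have fix_x: "f x = x" using H0_iff fX x by blast
  have "y = x" if y: "y \<in> X" "f y = y" for y
  proof -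
    have "\<F> y x = H0"
    proof (rule Delta_plus_eq_H0)
      \<comment> \<open>Between two fixed points, \<open>d = 1 - \<F> y x (ereal t)\<close>
        satisfies \<open>d \<le> d / 2\<close>, hence \<open>d \<le> 0\<close>.\<close>
      show "\<F> y x (ereal t) \<ge> 1" if "t > 0" for t
        using half[OF y(1) x that] y(2) fix_x by simp
    qed (intro D y x)
    then show ?thesis using H0_iff y x by blast
  qed
  with x fix_x show ?thesis by blast
qed

end
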